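(* Let $\mathcal{S}=(V,\Sigma,\delta)$ be a nondeterministic fuzzy transition system, $\alpha\in[0,1]$ and $k\in\mathbb{N}$. Then: (1) A relation $R\subseteq V\times V$ is a $k$-limited $\alpha$-bisimulation if and only if $R$ is a post-fixed point of $F_k^{\alpha}$, i.e. $R\subseteq F_k^{\alpha}(R)$. (2) If $R_1,R_2\subseteq V\times V$ are post-fixed points of $F_k^{\alpha}$, then so is $R_1\cup R_2$.
   Context: Let $\otimes$ be a fixed left-continuous $t$-norm on $[0,1]$: commutative, associative, increasing, with neutral element $1$, and $r\otimes\bigvee_i r_i=\bigvee_i (r\otimes r_i)$. Its residuum is $t\rightarrow r=\bigvee\{s\in[0,1]: s\otimes t\le r\}$. $\wedge,\vee$ (and $\bigwedge,\bigvee$) are min, max (inf, sup) in $[0,1]$; $\mathbb{N}$ contains $0$. $V$ is a nonempty finite set; $\mathcal{R}(V)$ is the set of fuzzy subsets of $V$ (maps $V\to[0,1]$), also called distributions. For $p\in\mathcal{R}(V)$ and $X\subseteq V$, $p(X)=\bigvee_{x\in X}p(x)$ (with $p(\emptyset)=0$). A nondeterministic fuzzy transition system (NFTS) is a triple $\mathcal{S}=(V,\Sigma,\delta)$ with $\Sigma$ a set of labels and $\delta\subseteq V\times\Sigma\times\mathcal{R}(V)$; $\delta(u,\tau)=\{p:(u,\tau,p)\in\delta\}$, and $u\overset{\tau}{\longrightarrow}p$ means $p\in\delta(u,\tau)$. For $R\subseteq V\times V$: $\overrightarrow{R}_u=\{v:(u,v)\in R\}$, $\overleftarrow{R}_u=\{v:(v,u)\in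 R\}$, and $\widetilde{S}(p,q,R)=\bigwedge_{u\in V}\big((p(u)\rightarrow q(\overrightarrow{R}_u))\wedge(q(u)\rightarrow p(\overleftarrow{R}_u))\big)$. The lifted relation is $R_\alpha^{\dagger}=\{(p,q)\in\mathcal{R}(V)\times\mathcal{R}(V):\widetilde{S}(p,q,R)\ge\alpha\}$. $k$-limited $\alpha$-bisimilarity $\approx_k^{\alpha}\subseteq V\times V$: $u\approx_0^\alpha v$ for all $u,v$; and $u\approx_{i+1}^\alpha v$ iff for each $\tau\in\Sigma$: $u\overset{\tau}{\longrightarrow}p$ implies there is $v\overset{\tau}{\longrightarrow}q$ with $(p,q)\in(\approx_i^\alpha)_\alpha^\dagger$; and $v\overset{\tau}{\longrightarrow}q$ implies there is $u\overset{\tau}{\longrightarrow}p$ with $(p,q)\in(\approx_i^\alpha)_\alpha^\dagger$. A $k$-limited $\alpha$-bisimulation is any subset of $\approx_k^\alpha$. For $X\subseteq V$, $\mathrm{Succ}(X)=\{v\in V:\exists u\in X,\tau\in\Sigma,p\in\delta(u,\tau)\text{ with }p(v)>0\}$. For $R\subseteq V\times V$ let $\mathrm{dom}(R)=\{u:\exists v,(u,v)\in R\}$ and $\mathrm{ran}(R)=\{v:\exists u,(u,v)\in R\}$. The functions $F_k^\alpha:\mathcal{P}(V\times V)\to\mathcal{P}(V\times V)$ are defined recursively: $F_0^\alpha(R)=R$; and $F_{i+1}^\alpha(R)$ is the set of $(u,v)\in V\times V$ such that, with $G=F_i^\alpha(\mathrm{Succ}(\mathrm{dom}(R))\times\mathrm{Succ}(\mathrm{ran}(R)))$,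 for every $\tau\in\Sigma$: for every $u\overset{\tau}{\longrightarrow}p$ there is $v\overset{\tau}{\longrightarrow}q$ with $(p,q)\in G_\alpha^\dagger$, and for every $v\overset{\tau}{\longrightarrow}q$ there is $u\overset{\tau}{\longrightarrow}p$ with $(p,q)\in G_\alpha^\dagger$. *)

theory Defs
  imports Complex_Main "HOL-Library.FuncSet"
begin

text \<open>
  Truth values are the reals in \<open>{0..1}\<close>. All suprema and infima below are taken over sets that
  are nonempty and bounded whenever the locale assumptions hold, so the conditionally complete
  \<open>Sup\<close> and \<open>Inf\<close> of the reals agree with those of the complete lattice $[0,1]$. The one
  exception, the supremum over the empty set, is treated separately in \<open>value_on\<close>.
\<close>

text \<open>
  In \<open>tnorm_Sup\<close> the empty family is left out; for it the equation reads \<open>T r 0 = 0\<close>, which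
  follows from the other assumptions.
\<close>

locale left_continuous_tnorm =
  fixes T :: "real \<Rightarrow> real \<Rightarrow> real"
  assumes tnorm_closed: "\<lbrakk>r \<in> {0..1}; s \<in> {0..1}\<rbrakk> \<Longrightarrow> T r s \<in> {0..1}"
    and tnorm_commute: "\<lbrakk>r \<in> {0..1}; s \<in> {0..1}\<rbrakk> \<Longrightarrow> T r s = T s r"
    and tnorm_assoc: "\<lbrakk>r \<in> {0..1}; s \<in> {0..1}; t \<in> {0..1}\<rbrakk> \<Longrightarrow> T (T r s) t = T r (T s t)"
    and tnorm_mono: "\<lbrakk>r \<in> {0..1}; r' \<in> {0..1}; s \<in> {0..1}; s' \<in> {0..1}; r \<le> r'; s \<le> s'\<rbrakk>
      \<Longrightarrow> T r s \<le> T r' s'"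
    and tnorm_neutral: "r \<in> {0..1} \<Longrightarrow> T r 1 = r"
    and tnorm_Sup: "\<lbrakk>r \<in> {0..1}; A \<subseteq> {0..1}; A \<noteq> {}\<rbrakk> \<Longrightarrow> T r (Sup A) = (SUP s\<in>A. T r s)"

definition residuum :: "(real \<Rightarrow> real \<Rightarrow> real) \<Rightarrow> real \<Rightarrow> real \<Rightarrow> real" where
  "residuum T t r = Sup {s \<in> {0..1}. T s t \<le> r}"

text \<open>
  Fuzzy subsets of the carrier \<open>V\<close> are extensional functions, so that maps with the same values
  on \<open>V\<close> are identified.
\<close>

definition fuzzy_sets :: "'v set \<Rightarrow> ('v \<Rightarrow> real) set" where
  "fuzzy_sets V = V \<rightarrow>\<^sub>E {0..1}"

definition value_on :: "('v \<Rightarrow> real) \<Rightarrow> 'v set \<Rightarrow> real" where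
  "value_on p X = (if X = {} then 0 else (SUP x\<in>X. p x))"

locale nfts =
  fixes V :: "'v set" and \<Sigma> :: "'l set" and \<delta> :: "('v \<times> 'l \<times> ('v \<Rightarrow> real)) set"
  assumes finite_states: "finite V"
    and nonempty_states: "V \<noteq> {}"
    and transitions_subset: "\<delta> \<subseteq> V \<times> \<Sigma> \<times> fuzzy_sets V"

definition steps :: "('v \<times> 'l \<times> ('v \<Rightarrow> real)) set \<Rightarrow> 'v \<Rightarrow> 'l \<Rightarrow> ('v \<Rightarrow> real) set" where
  "steps \<delta> u \<tau> = {p. (u, \<tau>, p) \<in> \<delta>}"

definition dist_similarity ::
  "(real \<Rightarrow> real \<Rightarrow> real) \<Rightarrow> 'v set \<Rightarrow> ('v \<Rightarrow> real) \<Rightarrow> ('v \<Rightarrow> real) \<Rightarrow> ('v \<times> 'v) set \<Rightarrow> real" where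
  "dist_similarity T V p q R =
    (INF u\<in>V. min (residuum T (p u) (value_on q (R `` {u})))
                    (residuum T (q u) (value_on p (R\<inverse> `` {u}))))"

definition lifted_rel ::
  "(real \<Rightarrow> real \<Rightarrow> real) \<Rightarrow> 'v set \<Rightarrow> real \<Rightarrow> ('v \<times> 'v) set \<Rightarrow> (('v \<Rightarrow> real) \<times> ('v \<Rightarrow> real)) set" where
  "lifted_rel T V \<alpha> R =
    {(p, q) \<in> fuzzy_sets V \<times> fuzzy_sets V. dist_similarity T V p q R \<ge> \<alpha>}"

text \<open>
  The back-and-forth condition that is common to the recursive clauses of \<open>limited_bisimilarity\<close>
  and \<open>limited_fun\<close>; distributions are compared through the lifting of \<open>G\<close>.
\<close>

definition transfer_pairs ::
  "(real \<Rightarrow> real \<Rightarrow> real) \<Rightarrow> 'v set \<Rightarrow> 'l set \<Rightarrow> ('v \<times> 'l \<times> ('v \<Rightarrow> real)) set \<Rightarrow> real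
    \<Rightarrow> ('v \<times> 'v) set \<Rightarrow> ('v \<times> 'v) set" where
  "transfer_pairs T V \<Sigma> \<delta> \<alpha> G =
    {(u, v) \<in> V \<times> V. \<forall>\<tau>\<in>\<Sigma>.
      (\<forall>p\<in>steps \<delta> u \<tau>. \<exists>q\<in>steps \<delta> v \<tau>. (p, q) \<in> lifted_rel T V \<alpha> G) \<and>
      (\<forall>q\<in>steps \<delta> v \<tau>. \<exists>p\<in>steps \<delta> u \<tau>. (p, q) \<in> lifted_rel T V \<alpha> G)}"

primrec limited_bisimilarity ::
  "(real \<Rightarrow> real \<Rightarrow> real) \<Rightarrow> 'v set \<Rightarrow> 'l set \<Rightarrow> ('v \<times> 'l \<times> ('v \<Rightarrow> real)) set \<Rightarrow> real
    \<Rightarrow> nat \<Rightarrow> ('v \<times> 'v) set" where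
  "limited_bisimilarity T V \<Sigma> \<delta> \<alpha> 0 = V \<times> V"
| "limited_bisimilarity T V \<Sigma> \<delta> \<alpha> (Suc i) =
    transfer_pairs T V \<Sigma> \<delta> \<alpha> (limited_bisimilarity T V \<Sigma> \<delta> \<alpha> i)"

definition limited_bisimulation ::
  "(real \<Rightarrow> real \<Rightarrow> real) \<Rightarrow> 'v set \<Rightarrow> 'l set \<Rightarrow> ('v \<times> 'l \<times> ('v \<Rightarrow> real)) set \<Rightarrow> real
    \<Rightarrow> nat \<Rightarrow> ('v \<times> 'v) set \<Rightarrow> bool" where
  "limited_bisimulation T V \<Sigma> \<delta> \<alpha> k R \<longleftrightarrow> R \<subseteq> limited_bisimilarity T V \<Sigma> \<delta> \<alpha> k"

definition Succ ::
  "'v set \<Rightarrow> 'l set \<Rightarrow> ('v \<times> 'l \<times> ('v \<Rightarrow> real)) set \<Rightarrow> 'v set \<Rightarrow> 'v set" where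
  "Succ V \<Sigma> \<delta> X = {v \<in> V. \<exists>u\<in>X. \<exists>\<tau>\<in>\<Sigma>. \<exists>p\<in>steps \<delta> u \<tau>. p v > 0}"

primrec limited_fun ::
  "(real \<Rightarrow> real \<Rightarrow> real) \<Rightarrow> 'v set \<Rightarrow> 'l set \<Rightarrow> ('v \<times> 'l \<times> ('v \<Rightarrow> real)) set \<Rightarrow> real
    \<Rightarrow> nat \<Rightarrow> ('v \<times> 'v) set \<Rightarrow> ('v \<times> 'v) set" where
  "limited_fun T V \<Sigma> \<delta> \<alpha> 0 R = R"
| "limited_fun T V \<Sigma> \<delta> \<alpha> (Suc i) R =
    transfer_pairs T V \<Sigma> \<delta> \<alpha>
      (limited_fun T V \<Sigma> \<delta> \<alpha> i (Succ V \<Sigma> \<delta> (Domain R) \<times> Succ V \<Sigma> \<delta> (Range R)))"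

definition post_fixed_point :: "('a set \<Rightarrow> 'a set) \<Rightarrow> 'a set \<Rightarrow> bool" where
  "post_fixed_point F R \<longleftrightarrow> R \<subseteq> F R"

end

theory Submission
  imports Defs
begin

text \<open>
  The lifting of a relation \<open>G\<close> to a pair of distributions \<open>(p, q)\<close> depends only on the part of
  \<open>G\<close> between the supports of \<open>p\<close> and \<open>q\<close> (\<open>lifted_rel_Int_support\<close>). In the
  residuum \<open>p(u) \<rightarrow> q(G\<^sub>u)\<close>, a state \<open>u\<close> outside the support of \<open>p\<close> imposes no constraint, because
  \<open>0\<close> is the least truth value and its residuum into anything is \<open>1\<close>; and a state outside the
  support of \<open>q\<close> contributes only a \<open>0\<close> to the supremum \<open>q(G\<^sub>u)\<close>. The other residuum is the same
  with \<open>p\<close> and \<open>q\<close> exchanged and \<open>G\<close> transposed.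

  Every distribution reachable in one step from \<open>dom(R)\<close> is supported in \<open>Succ(dom(R))\<close>, and
  likewise for \<open>ran(R)\<close>. Hence, when only pairs in \<open>R\<close> are tested, the transfer condition does not
  see the difference between two relations that agree on \<open>Succ(dom(R)) \<times> Succ(ran(R))\<close>. Induction
  on \<open>k\<close>, with \<open>R\<close> arbitrary, turns this into the equation \<open>R \<inter> F\<^sub>k(R) = R \<inter> \<approx>\<^sub>k\<close>
  (\<open>limited_fun_Int_eq\<close>). So \<open>R \<subseteq> F\<^sub>k(R)\<close> iff \<open>R \<subseteq> \<approx>\<^sub>k\<close>, and the
  second condition on \<open>R\<close> is evidently closed under unions.
\<close>

lemma fuzzy_sets_bounds:
  assumes "q \<in> fuzzy_sets V" and "x \<in> V"
  shows "0 \<le> q x" and "q x \<le> 1"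
  using assms by (auto simp: fuzzy_sets_def PiE_iff)

lemma value_on_bounds:
  assumes q: "q \<in> fuzzy_sets V" and X: "X \<subseteq> V"
  shows "0 \<le> value_on q X" and "x \<in> X \<Longrightarrow> q x \<le> value_on q X"
proof -
  have "bdd_above (q ` X)"
    using fuzzy_sets_bounds(2)[OF q] X by (intro bdd_aboveI2[where M = 1]) auto
  then have upper: "q x \<le> value_on q X" if "x \<in> X" for x
    using that by (auto simp: value_on_def intro: cSUP_upper)
  show "0 \<le> value_on q X"
  proof (cases "X = {}")
    case False
    then obtain x where "x \<in> X" by blast
    then show ?thesis
      using upper[of x] fuzzy_sets_bounds(1)[OF q, of x] X by auto
  qed (simp add: value_on_def)
  show "q x \<le> value_on q X" if "x \<in> X"
    using upper that .
qed

lemma value_on_least: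
  assumes "0 \<le> c" and "\<And>x. x \<in> X \<Longrightarrow> q x \<le> c"
  shows "value_on q X \<le> c"
  using assms by (auto simp: value_on_def intro: cSUP_least)

lemma value_on_Int_support:
  assumes q: "q \<in> fuzzy_sets V" and X: "X \<subseteq> V"
    and supp: "\<And>x. x \<in> V \<Longrightarrow> x \<notin> B \<Longrightarrow> q x = 0"
  shows "value_on q (X \<inter> B) = value_on q X"
proof (rule antisym)
  have XB: "X \<inter> B \<subseteq> V" using X by blast
  show "value_on q (X \<inter> B) \<le> value_on q X"
    using value_on_bounds[OF q X] by (intro value_on_least) auto
  show "value_on q X \<le> value_on q (X \<inter> B)"
  proof (rule value_on_least)
    show "0 \<le> value_on q (X \<inter> B)" using value_on_bounds(1)[OF q XB] .
    show "q x \<le> value_on q (X \<inter> B)" if "x \<in> X" for x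
      using that X supp[of x] value_on_bounds[OF q XB] by (cases "x \<in> B") auto
  qed
qed

context left_continuous_tnorm
begin

lemma tnorm_zero_right:
  assumes "s \<in> {0..1}"
  shows "T s 0 = 0"
proof -
  have "T s 0 \<le> T 1 0" using assms by (intro tnorm_mono) auto
  also have "T 1 0 = 0" using tnorm_commute[of 1 0] tnorm_neutral[of 0] by simp
  finally show ?thesis using tnorm_closed[OF assms, of 0] by simp
qed

lemma residuum_zero_left:
  assumes "0 \<le> r"
  shows "residuum T 0 r = 1"
proof -
  have "{s \<in> {0..1}. T s 0 \<le> r} = {0..1}"
    using tnorm_zero_right assms by auto
  then show ?thesis by (simp add: residuum_def)
qed

text \<open>
  One half of the similarity. For \<open>u\<close> outside \<open>A\<close> the section \<open>G\<^sub>u\<close> may change,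
  but then both residua equal \<open>1\<close>; for \<open>u\<close> in \<open>A\<close> only points where \<open>q\<close> is \<open>0\<close> leave the section.
\<close>

lemma residuum_value_on_Int_support:
  assumes q: "q \<in> fuzzy_sets V" and G: "G \<subseteq> V \<times> V" and u: "u \<in> V"
    and suppp: "\<And>x. x \<in> V \<Longrightarrow> x \<notin> A \<Longrightarrow> p x = 0"
    and suppq: "\<And>x. x \<in> V \<Longrightarrow> x \<notin> B \<Longrightarrow> q x = 0"
  shows "residuum T (p u) (value_on q ((G \<inter> A \<times> B) `` {u})) =
    residuum T (p u) (value_on q (G `` {u}))"
proof (cases "u \<in> A")
  case True
  then have "(G \<inter> A \<times> B) `` {u} = G `` {u} \<inter> B" by blast
  moreover have "G `` {u} \<subseteq> V" using G by blast
  ultimately show ?thesis using value_on_Int_support[OF q _ suppq] by simp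
next
  case False
  moreover have "0 \<le> value_on q ((G \<inter> A \<times> B) `` {u})" "0 \<le> value_on q (G `` {u})"
    using G by (auto intro!: value_on_bounds(1)[OF q])
  ultimately show ?thesis using suppp[OF u] by (simp add: residuum_zero_left)
qed

lemma lifted_rel_Int_support:
  assumes G: "G \<subseteq> V \<times> V"
    and suppp: "\<And>x. x \<in> V \<Longrightarrow> x \<notin> A \<Longrightarrow> p x = 0"
    and suppq: "\<And>x. x \<in> V \<Longrightarrow> x \<notin> B \<Longrightarrow> q x = 0"
  shows "(p, q) \<in> lifted_rel T V \<alpha> (G \<inter> A \<times> B) \<longleftrightarrow> (p, q) \<in> lifted_rel T V \<alpha> G"
proof (cases "p \<in> fuzzy_sets V \<and> q \<in> fuzzy_sets V")
  case True
  have forward: "residuum T (p u) (value_on q ((G \<inter> A \<times> B) `` {u})) =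
      residuum T (p u) (value_on q (G `` {u}))" if "u \<in> V" for u
    using True G that suppp suppq by (intro residuum_value_on_Int_support[where V = V]) auto
  have conv: "(G \<inter> A \<times> B)\<inverse> = G\<inverse> \<inter> B \<times> A" and Gc: "G\<inverse> \<subseteq> V \<times> V"
    using G by auto
  have backward: "residuum T (q u) (value_on p ((G \<inter> A \<times> B)\<inverse> `` {u})) =
      residuum T (q u) (value_on p (G\<inverse> `` {u}))" if "u \<in> V" for u
    unfolding conv using True Gc that suppp suppq
    by (intro residuum_value_on_Int_support[where V = V]) auto
  have "dist_similarity T V p q (G \<inter> A \<times> B) = dist_similarity T V p q G"
    unfolding dist_similarity_def by (intro INF_cong refl) (simp only: forward backward)
  then show ?thesis by (simp add: lifted_rel_def)
qed (auto simp: lifted_rel_def)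

end

text \<open>
  This is where the restriction to \<open>Succ(X)\<close> in the definition of \<open>F\<^sub>k\<close> comes from: it contains the
  support of every distribution reachable in one step from \<open>X\<close>.
\<close>

lemma (in nfts) steps_eq_0_outside_Succ:
  assumes "u \<in> X" and "\<tau> \<in> \<Sigma>" and p: "p \<in> steps \<delta> u \<tau>" and "x \<in> V" and "x \<notin> Succ V \<Sigma> \<delta> X"
  shows "p x = 0"
proof -
  have "p \<in> fuzzy_sets V" using p transitions_subset by (auto simp: steps_def)
  moreover have "\<not> p x > 0" using assms by (auto simp: Succ_def)
  ultimately show ?thesis using fuzzy_sets_bounds(1)[of p V x] \<open>x \<in> V\<close> by simp
qed

lemma transfer_pairs_subset: "transfer_pairs T V \<Sigma> \<delta> \<alpha> G \<subseteq> V \<times> V"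
  by (auto simp: transfer_pairs_def)

lemma limited_bisimilarity_subset: "limited_bisimilarity T V \<Sigma> \<delta> \<alpha> k \<subseteq> V \<times> V"
  by (cases k) (simp_all add: transfer_pairs_subset)

lemma limited_fun_subset:
  assumes "R \<subseteq> V \<times> V"
  shows "limited_fun T V \<Sigma> \<delta> \<alpha> k R \<subseteq> V \<times> V"
  using assms by (cases k) (simp_all add: transfer_pairs_subset)

text \<open>
  Locality of the transfer condition: a pair in \<open>R\<close> only compares distributions supported in the
  successors of the domain and of the range of \<open>R\<close>, so \<open>G\<close> and \<open>H\<close> are both interchangeable with
  their common restriction.
\<close>

lemma transfer_pairs_Int_cong:
  assumes T: "left_continuous_tnorm T" and S: "nfts V \<Sigma> \<delta>"
    and G: "G \<subseteq> V \<times> V" and H: "H \<subseteq> V \<times> V"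
    and agree: "Succ V \<Sigma> \<delta> (Domain R) \<times> Succ V \<Sigma> \<delta> (Range R) \<inter> G =
      Succ V \<Sigma> \<delta> (Domain R) \<times> Succ V \<Sigma> \<delta> (Range R) \<inter> H"
  shows "R \<inter> transfer_pairs T V \<Sigma> \<delta> \<alpha> G = R \<inter> transfer_pairs T V \<Sigma> \<delta> \<alpha> H"
proof -
  let ?A = "Succ V \<Sigma> \<delta> (Domain R)" and ?B = "Succ V \<Sigma> \<delta> (Range R)"
  have lifted: "(p, q) \<in> lifted_rel T V \<alpha> G \<longleftrightarrow> (p, q) \<in> lifted_rel T V \<alpha> H"
    if "(u, v) \<in> R" "\<tau> \<in> \<Sigma>" and p: "p \<in> steps \<delta> u \<tau>" and q: "q \<in> steps \<delta> v \<tau>" for u v \<tau> p q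
  proof -
    have suppp: "p x = 0" if "x \<in> V" "x \<notin> ?A" for x
      using nfts.steps_eq_0_outside_Succ[OF S _ \<open>\<tau> \<in> \<Sigma>\<close> p that] \<open>(u, v) \<in> R\<close> by blast
    have suppq: "q x = 0" if "x \<in> V" "x \<notin> ?B" for x
      using nfts.steps_eq_0_outside_Succ[OF S _ \<open>\<tau> \<in> \<Sigma>\<close> q that] \<open>(u, v) \<in> R\<close> by blast
    have "G \<inter> ?A \<times> ?B = H \<inter> ?A \<times> ?B" using agree by blast
    moreover have "(p, q) \<in> lifted_rel T V \<alpha> (K \<inter> ?A \<times> ?B) \<longleftrightarrow> (p, q) \<in> lifted_rel T V \<alpha> K"
      if "K \<subseteq> V \<times> V" for K
      using left_continuous_tnorm.lifted_rel_Int_support[OF T that, where p = p and q = q]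
        suppp suppq by blast
    ultimately show ?thesis using G H by metis
  qed
  have "(u, v) \<in> transfer_pairs T V \<Sigma> \<delta> \<alpha> G \<longleftrightarrow> (u, v) \<in> transfer_pairs T V \<Sigma> \<delta> \<alpha> H"
    if "(u, v) \<in> R" for u v
    unfolding transfer_pairs_def using lifted[OF that] by simp
  then show ?thesis by auto
qed

text \<open>
  The induction needs \<open>R\<close> arbitrary, since the recursive call of \<open>F\<^sub>k\<close> is at the product of the
  successor sets. That instance of the induction hypothesis is exactly the agreement which
  locality of the transfer condition asks for.
\<close>

lemma limited_fun_Int_eq:
  assumes T: "left_continuous_tnorm T" and S: "nfts V \<Sigma> \<delta>" and R: "R \<subseteq> V \<times> V"
  shows "R \<inter> limited_fun T V \<Sigma> \<delta> \<alpha> k R = R \<inter> limited_bisimilarity T V \<Sigma> \<delta> \<alpha> k"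
  using R
proof (induction k arbitrary: R)
  case 0
  then show ?case by auto
next
  case (Suc k)
  have prod: "Succ V \<Sigma> \<delta> (Domain R) \<times> Succ V \<Sigma> \<delta> (Range R) \<subseteq> V \<times> V"
    by (auto simp: Succ_def)
  show ?case
    unfolding limited_fun.simps limited_bisimilarity.simps
    using Suc.IH[OF prod] limited_fun_subset[OF prod] limited_bisimilarity_subset
    by (intro transfer_pairs_Int_cong[OF T S])
qed

lemma limited_bisimulation_iff_post_fixed_point:
  assumes "left_continuous_tnorm T" and "nfts V \<Sigma> \<delta>" and "R \<subseteq> V \<times> V"
  shows "limited_bisimulation T V \<Sigma> \<delta> \<alpha> k R \<longleftrightarrow>
    post_fixed_point (limited_fun T V \<Sigma> \<delta> \<alpha> k) R"
  using limited_fun_Int_eq[OF assms, of \<alpha> k]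
  unfolding limited_bisimulation_def post_fixed_point_def by blast

lemma limited_bisimulation_Un:
  assumes "limited_bisimulation T V \<Sigma> \<delta> \<alpha> k R" and "limited_bisimulation T V \<Sigma> \<delta> \<alpha> k R'"
  shows "limited_bisimulation T V \<Sigma> \<delta> \<alpha> k (R \<union> R')"
  using assms by (simp add: limited_bisimulation_def)

theorem theorem4p1:
  fixes T :: "real \<Rightarrow> real \<Rightarrow> real"
    and V :: "'v set" and \<Sigma> :: "'l set" and \<delta> :: "('v \<times> 'l \<times> ('v \<Rightarrow> real)) set"
    and \<alpha> :: real and k :: nat
  assumes "left_continuous_tnorm T"
    and "nfts V \<Sigma> \<delta>"
    and "\<alpha> \<in> {0..1}"
  shows "(\<forall>R. R \<subseteq> V \<times> V \<longrightarrow>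
            (limited_bisimulation T V \<Sigma> \<delta> \<alpha> k R \<longleftrightarrow>
             post_fixed_point (limited_fun T V \<Sigma> \<delta> \<alpha> k) R)) \<and>
         (\<forall>R\<^sub>1 R\<^sub>2. R\<^sub>1 \<subseteq> V \<times> V \<longrightarrow> R\<^sub>2 \<subseteq> V \<times> V \<longrightarrow>
            post_fixed_point (limited_fun T V \<Sigma> \<delta> \<alpha> k) R\<^sub>1 \<longrightarrow>
            post_fixed_point (limited_fun T V \<Sigma> \<delta> \<alpha> k) R\<^sub>2 \<longrightarrow>
            post_fixed_point (limited_fun T V \<Sigma> \<delta> \<alpha> k) (R\<^sub>1 \<union> R\<^sub>2))"
  using limited_bisimulation_iff_post_fixed_point[OF assms(1,2)] limited_bisimulation_Un
  by (metis Un_least)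

end
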